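(* Consider the planar Newtonian 4-body problem. Suppose that a planar central configuration of four bodies with positive masses is a concave kite and that the masses consist of two pairs of equal masses. Then one pair of equal masses lies at the two endpoints of the base of an isosceles triangle, and the other pair lies on the symmetry axis of that base, with one body of this second pair lying inside the triangle formed by the other three bodies. Moreover, these concave kite central configurations (considered up to equivalence) form a single-parameter family: normalizing $m_1=m_2=1$ at $q_1=(-1,0)$, $q_2=(1,0)$ and $m_3=m_4=m$ at $q_3=(0,\sqrt{a^2-1})$, $q_4=(0,\sqrt{b^2-1})$ with $1<a<b$ (so $a=|q_1-q_3|$, $b=|q_1-q_4|$), the family is parameterized by $a\in(1,2)$, in the sense that each such $a$ uniquely determines $b$ and the mass ratio $m>0$.
   Context: Bodies with positive masses $m_i$ at positions $q_i\in\mathbb{R}^2$, $i=1,\dots,4$, with mutual distances $r_{ij}=|q_i-q_j|$ and Newtonian potential $U=\sum_{i<j} m_im_j/r_{ij}$. A configuration $q=(q_1,\dots,q_4)$ is a central configuration if there is a constant $\lambda$ such that $-\lambda m_j(q_j-c)=\sum_{i\neq j} m_im_j(q_i-q_j)/r_{ij}^3$ for all $j$, where $c=\sum m_iq_i/\sum m_i$ is the center of mass. Two central configurations are equivalent if one is obtained from the other by translation, dilation and rotation. A non-collinear configuration is a kite if it has a symmetry axis passing through two of the four bodies; it is (strictly) concave if one body lies in the interior of the triangle formed by the other three. *)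

theory Defs
  imports "HOL-Analysis.Analysis"
begin

definition bodies :: "nat set" where
  "bodies = {1..4}"

definition center_of_mass :: "(nat \<Rightarrow> real) \<Rightarrow> (nat \<Rightarrow> complex) \<Rightarrow> complex" where
  "center_of_mass m q = (1 / (\<Sum>i\<in>bodies. m i)) *\<^sub>R (\<Sum>i\<in>bodies. m i *\<^sub>R q i)"

text \<open>Central configuration with positive masses and pairwise distinct positions
  (so that all mutual distances r_ij are positive and U is defined).\<close>
definition central_config :: "(nat \<Rightarrow> real) \<Rightarrow> (nat \<Rightarrow> complex) \<Rightarrow> bool" where
  "central_config m q \<longleftrightarrow>
     (\<forall>i\<in>bodies. 0 < m i) \<and> inj_on q bodies \<and>
     (\<exists>lam::real. \<forall>j\<in>bodies.
        - (lam * m j) *\<^sub>R (q j - center_of_mass m q)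
          = (\<Sum>i\<in>bodies - {j}. (m i * m j / (cmod (q i - q j)) ^ 3) *\<^sub>R (q i - q j)))"

definition reflect :: "complex \<Rightarrow> complex \<Rightarrow> complex \<Rightarrow> complex" where
  "reflect a b z = a + (b - a) * cnj ((z - a) / (b - a))"

definition is_kite :: "(nat \<Rightarrow> complex) \<Rightarrow> bool" where
  "is_kite q \<longleftrightarrow> \<not> collinear (q ` bodies) \<and>
     (\<exists>i\<in>bodies. \<exists>j\<in>bodies. i \<noteq> j \<and> q i \<noteq> q j \<and>
        reflect (q i) (q j) ` (q ` bodies) = q ` bodies)"

definition is_concave :: "(nat \<Rightarrow> complex) \<Rightarrow> bool" where
  "is_concave q \<longleftrightarrow> (\<exists>k\<in>bodies. q k \<in> interior (convex hull (q ` (bodies - {k}))))"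

definition two_pairs_equal :: "(nat \<Rightarrow> real) \<Rightarrow> bool" where
  "two_pairs_equal m \<longleftrightarrow> (\<exists>i j k l. {i, j, k, l} = bodies \<and> m i = m j \<and> m k = m l)"

definition norm_pos :: "real \<Rightarrow> real \<Rightarrow> nat \<Rightarrow> complex" where
  "norm_pos a b i = (if i = 1 then -1 else if i = 2 then 1
      else if i = 3 then Complex 0 (sqrt (a\<^sup>2 - 1)) else Complex 0 (sqrt (b\<^sup>2 - 1)))"

definition norm_mass :: "real \<Rightarrow> nat \<Rightarrow> real" where
  "norm_mass mu i = (if i \<le> 2 then 1 else mu)"

end

theory Submission
  imports Defs
begin

text \<open>
  In a concave kite the inner body lies on the symmetry axis, since otherwise its mirror image
  would be a second inner body. Subtracting the equations of the two axis bodies and taking the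
  component orthogonal to the axis shows that the two off-axis bodies have equal masses, because
  the inner body is closer to them than the apex is.

  For the normalized kite with axis bodies at heights \<open>x < y\<close> put \<open>A = a\<^bsup>-3\<^esup>\<close>, \<open>B = b\<^bsup>-3\<^esup>\<close> and
  \<open>D = (y - x)\<^bsup>-3\<^esup>\<close>. Eliminating the multiplier leaves
  \<open>\<mu> (y - x) (D - B) = 2 x (A - 1/8)\<close> and \<open>\<mu> (y - x) (D - A) = 2 y (1/8 - B)\<close>.
  As \<open>D > B\<close>, the first equation forces \<open>A > 1/8\<close>, that is \<open>a < 2\<close>, and determines \<open>\<mu>\<close> from \<open>y\<close>.
  The quotient of the two equations is \<open>y (1/8 - B) = x (A - 1/8) (D - A) / (D - B)\<close>, whose left
  side increases for \<open>y \<ge> 1\<close> while its right side decreases; every solution has \<open>y > 1\<close>, because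
  \<open>y < \<surd>3\<close> gives \<open>B > 1/8\<close>, hence \<open>D < A\<close> and \<open>y > x + a\<close>. The two sides cross between
  \<open>y = \<surd>3\<close>, where the left side vanishes, and \<open>y = x + a\<close>, where the right side vanishes.
\<close>

section \<open>Reflections and convex hulls in coordinates along the axis\<close>

lemma bodies_eq: "bodies = {1, 2, 3, 4}"
  by (auto simp: bodies_def)

text \<open>In this coordinate the reflection in the line through \<open>a\<close> and \<open>b\<close> is complex conjugation.\<close>

definition axis_coord :: "complex \<Rightarrow> complex \<Rightarrow> complex \<Rightarrow> complex" where
  "axis_coord a b z = (z - a) / (b - a)"

lemma axis_coord_simps [simp]:
  "axis_coord a b a = 0" "a \<noteq> b \<Longrightarrow> axis_coord a b b = 1"
  by (simp_all add: axis_coord_def)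

lemma axis_coord_inverse:
  "a \<noteq> b \<Longrightarrow> z - a = axis_coord a b z * (b - a)"
  "a \<noteq> b \<Longrightarrow> z - b = (axis_coord a b z - 1) * (b - a)"
  by (simp_all add: axis_coord_def field_simps)

lemma axis_coord_reflect [simp]:
  "a \<noteq> b \<Longrightarrow> axis_coord a b (reflect a b z) = cnj (axis_coord a b z)"
  by (simp add: axis_coord_def reflect_def)

text \<open>Exchanging the two axis points replaces the axis coordinate \<open>w\<close> by
  \<open>1 - w\<close>, a real affine change that commutes with conjugation.\<close>

lemma reflect_commute:
  assumes "a \<noteq> b"
  shows "reflect a b z = reflect b a z"
proof -
  define w where "w = (z - a) / (b - a)"
  have w': "(z - b) / (a - b) = 1 - w"
    using assms by (simp add: w_def field_simps)
  show ?thesis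
    unfolding reflect_def w' w_def [symmetric] by (simp add: algebra_simps)
qed

lemma collinear_if_coords_real:
  assumes ab: "a \<noteq> b" and real: "\<And>z. z \<in> S \<Longrightarrow> Im (axis_coord a b z) = 0"
  shows "collinear S"
  unfolding collinear_def
proof (intro exI[of _ "b - a"] ballI)
  fix x y assume xy: "x \<in> S" "y \<in> S"
  have *: "\<exists>r. z - a = r *\<^sub>R (b - a)" if "z \<in> S" for z
  proof
    have "complex_of_real (Re (axis_coord a b z)) = axis_coord a b z"
      using real[OF that] by (simp add: complex_eq_iff)
    then show "z - a = Re (axis_coord a b z) *\<^sub>R (b - a)"
      using axis_coord_inverse(1)[OF ab, of z] by (simp add: scaleR_conv_of_real)
  qed
  obtain r s where "x - a = r *\<^sub>R (b - a)" "y - a = s *\<^sub>R (b - a)"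
    using *[OF xy(1)] *[OF xy(2)] by blast
  then have "(x - a) - (y - a) = (r - s) *\<^sub>R (b - a)" by (simp only: scaleR_diff_left)
  then have "x - y = (r - s) *\<^sub>R (b - a)" by simp
  then show "\<exists>c. x - y = c *\<^sub>R (b - a)" ..
qed

text \<open>Conjugation negates imaginary parts, so an off-axis point can be sent neither to itself
  nor to \<open>a\<close> or \<open>b\<close>. Non-collinearity puts \<open>z\<close> or
  \<open>w\<close> off the axis, and the symmetry then puts the other one off it too.\<close>

lemma reflection_swaps:
  assumes ab: "a \<noteq> b" and S: "S = {a, b, z, w}" and nc: "\<not> collinear S"
    and img: "reflect a b ` S = S"
  shows "reflect a b z = w" and "Im (axis_coord a b z) \<noteq> 0"
proof -
  have swap: "reflect a b u = v \<and> Im (axis_coord a b v) = - Im (axis_coord a b u)"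
    if "S = {a, b, u, v}" "Im (axis_coord a b u) \<noteq> 0" for u v
  proof -
    have "reflect a b u \<in> {a, b, u, v}" using img that(1) by blast
    moreover have im: "Im (axis_coord a b (reflect a b u)) = - Im (axis_coord a b u)"
      using ab by simp
    have "reflect a b u \<notin> {a, b, u}"
    proof
      assume "reflect a b u \<in> {a, b, u}"
      then show False using im that(2) ab by (auto simp del: axis_coord_reflect)
    qed
    ultimately have "reflect a b u = v" by blast
    with im show ?thesis by simp
  qed
  have "Im (axis_coord a b z) \<noteq> 0 \<or> Im (axis_coord a b w) \<noteq> 0"
  proof (rule ccontr)
    assume "\<not> ?thesis"
    then have "Im (axis_coord a b u) = 0" if "u \<in> S" for u
      using that ab unfolding S by auto
    with collinear_if_coords_real[OF ab] nc show False by blast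
  qed
  then show off: "Im (axis_coord a b z) \<noteq> 0"
    using swap[of w z] S by (auto simp: insert_commute)
  show "reflect a b z = w"
    using swap[OF S off] by simp
qed

text \<open>\<open>axis_coord a b\<close> is affine, so it preserves barycentric weights.\<close>

lemma convex_hull3_coords:
  fixes x y z t a b :: complex
  assumes "t \<in> convex hull {x, y, z}"
  obtains u v w where "u \<ge> 0" "v \<ge> 0" "w \<ge> 0" "u + v + w = (1::real)"
    "axis_coord a b t =
      u *\<^sub>R axis_coord a b x + v *\<^sub>R axis_coord a b y + w *\<^sub>R axis_coord a b z"
proof -
  from assms(1) obtain u v w where uvw: "u \<ge> 0" "v \<ge> 0" "w \<ge> 0" "u + v + w = (1::real)"
    "t = u *\<^sub>R x + v *\<^sub>R y + w *\<^sub>R z"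
    by (auto simp: convex_hull_3)
  have "a = (u + v + w) *\<^sub>R a" using uvw by simp
  then have "t - a = u *\<^sub>R (x - a) + v *\<^sub>R (y - a) + w *\<^sub>R (z - a)"
    unfolding uvw(5) by (simp add: algebra_simps)
  then have "axis_coord a b t =
      u *\<^sub>R axis_coord a b x + v *\<^sub>R axis_coord a b y + w *\<^sub>R axis_coord a b z"
    by (simp add: axis_coord_def add_divide_distrib scaleR_conv_of_real)
  with uvw that show ?thesis by blast
qed

text \<open>On the three vertices the imaginary part of the coordinate is zero twice and the
  negative of that of \<open>z\<close> once; a convex combination cannot restore the sign.\<close>

lemma off_axis_not_in_hull:
  assumes ab: "a \<noteq> b" and off: "Im (axis_coord a b z) \<noteq> 0"
  shows "z \<notin> convex hull {a, b, reflect a b z}"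
proof
  assume "z \<in> convex hull {a, b, reflect a b z}"
  then obtain u v s where uvs: "s \<ge> (0::real)"
    "axis_coord a b z = u *\<^sub>R axis_coord a b a + v *\<^sub>R axis_coord a b b
      + s *\<^sub>R axis_coord a b (reflect a b z)"
    by (rule convex_hull3_coords[where a = a and b = b])
  have "Im (axis_coord a b z) = - s * Im (axis_coord a b z)"
    using arg_cong[OF uvs(2), of Im] ab by simp
  then have "(1 + s) * Im (axis_coord a b z) = 0" by (simp add: algebra_simps)
  with off uvs(1) show False by simp
qed

text \<open>In axis coordinates \<open>a\<close> is 0, \<open>b\<close> is 1, and \<open>z\<close>
  and its mirror image share one real part. Writing 0 as a convex combination forces that real part
  to be at most 0, which puts \<open>z\<close> closer to 0 than to 1.\<close>

lemma apex_further_than_inner_point: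
  assumes ab: "a \<noteq> b" and hull: "a \<in> convex hull {z, reflect a b z, b}"
  shows "cmod (z - a) < cmod (z - b)"
proof -
  define W where "W = axis_coord a b z"
  from hull obtain u v s where uvs: "u \<ge> 0" "v \<ge> 0" "s \<ge> 0" "u + v + s = (1::real)"
    "axis_coord a b a = u *\<^sub>R axis_coord a b z + v *\<^sub>R axis_coord a b (reflect a b z)
      + s *\<^sub>R axis_coord a b b"
    by (rule convex_hull3_coords[where a = a and b = b])
  have "0 = u * Re W + v * Re W + s"
    using arg_cong[OF uvs(5), of Re] ab by (simp add: W_def)
  then have 1: "(u + v) * Re W = - s" by (simp add: algebra_simps)
  \<comment> \<open>Otherwise \<open>s\<close> would vanish too, although the weights sum to
    1.\<close>
  have "u + v > 0" using 1 uvs by (cases "u + v = 0") auto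
  then have "Re W \<le> 0" using 1 uvs(3) by (smt (verit) mult_pos_pos)
  then have "(cmod W)\<^sup>2 < (cmod (W - 1))\<^sup>2"
    unfolding cmod_power2 by (simp add: power2_eq_square algebra_simps)
  then have "cmod W < cmod (W - 1)" by (simp add: power_less_imp_less_base)
  then show ?thesis
    using ab unfolding axis_coord_inverse[OF ab, of z] W_def
    by (simp add: norm_mult mult_strict_right_mono)
qed

lemma cmod_reflect_diff:
  assumes ab: "a \<noteq> b"
  shows "cmod (reflect a b z - a) = cmod (z - a)" and "cmod (reflect a b z - b) = cmod (z - b)"
proof -
  have *: "cmod (reflect a b z - a) = cmod (z - a)" if "a \<noteq> b" for a b
    unfolding axis_coord_inverse(1)[OF that, of z] axis_coord_inverse(1)[OF that, of "reflect a b z"]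
    using that by (simp add: norm_mult)
  show "cmod (reflect a b z - a) = cmod (z - a)" by (rule *[OF ab])
  show "cmod (reflect a b z - b) = cmod (z - b)"
    unfolding reflect_commute[OF ab] using * ab by metis
qed

text \<open>Links the component orthogonal to the axis, which is linear in \<open>z - a\<close>, to
  the axis coordinate.\<close>

lemma Im_mult_cnj_axis:
  assumes ab: "a \<noteq> b"
  shows "Im ((z - a) * cnj (b - a)) = Im (axis_coord a b z) * (cmod (b - a))\<^sup>2"
  unfolding axis_coord_inverse(1)[OF ab, of z]
  by (simp add: mult.assoc complex_norm_square [symmetric] del: complex_cnj_diff of_real_power)

section \<open>Which masses of a concave kite are equal\<close>

text \<open>With the factor \<open>m j\<close> cancelled, the multiplier term has the same
  coefficient for every body, so equations of two bodies can be subtracted.\<close>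

lemma central_config_force:
  assumes "central_config m q"
  shows "\<exists>lam. \<forall>j\<in>bodies.
    - lam *\<^sub>R (q j - center_of_mass m q) =
      (\<Sum>i\<in>bodies - {j}. (m i / cmod (q i - q j) ^ 3) *\<^sub>R (q i - q j))"
proof -
  from assms obtain lam where pos: "\<forall>j\<in>bodies. 0 < m j" and lam:
    "\<forall>j\<in>bodies. - (lam * m j) *\<^sub>R (q j - center_of_mass m q)
       = (\<Sum>i\<in>bodies - {j}. (m i * m j / (cmod (q i - q j)) ^ 3) *\<^sub>R (q i - q j))"
    unfolding central_config_def by blast
  have "- lam *\<^sub>R (q j - center_of_mass m q) =
      (\<Sum>i\<in>bodies - {j}. (m i / cmod (q i - q j) ^ 3) *\<^sub>R (q i - q j))" (is "?l = ?r")
    if j: "j \<in> bodies" for j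
  proof -
    have "m j *\<^sub>R ?l = m j *\<^sub>R ?r"
      using bspec[OF lam j] by (simp add: scaleR_sum_right mult.commute)
    moreover have "m j \<noteq> 0" using pos j by force
    ultimately show ?thesis by (simp only: scaleR_cancel_left) simp
  qed
  then show ?thesis by blast
qed

lemma distinct_if_eq_bodies:
  assumes "{i, j, k, l} = bodies"
  shows "distinct [i, j, k, l]"
proof -
  have "card {i, j, k, l} = 4" unfolding assms by (simp add: bodies_def)
  then show ?thesis by (auto simp: card_insert_if split: if_splits)
qed

lemma off_axis_masses_equal:
  assumes cc: "central_config m q" and ijkl: "{i, j, k, l} = bodies"
    and refl: "reflect (q k) (q l) (q i) = q j"
    and off: "Im (axis_coord (q k) (q l) (q i)) \<noteq> 0"
    and hull: "q k \<in> convex hull {q i, q j, q l}"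
  shows "m i = m j"
proof -
  have dist: "distinct [i, j, k, l]" by (rule distinct_if_eq_bodies[OF ijkl])
  have qkl: "q k \<noteq> q l" using off by (auto simp: axis_coord_def)
  from cc obtain lam where lam: "\<And>t. t \<in> bodies \<Longrightarrow>
    - lam *\<^sub>R (q t - center_of_mass m q) =
      (\<Sum>s\<in>bodies - {t}. (m s / cmod (q s - q t) ^ 3) *\<^sub>R (q s - q t))"
    using central_config_force by blast
  define R where "R = (\<lambda>s t. 1 / cmod (q s - q t) ^ 3)"
  \<comment> \<open>Up to a nonzero factor, the component orthogonal to the axis; it vanishes on
    \<open>q l - q k\<close>.\<close>
  define X where "X = (\<lambda>z. Im (z * cnj (q l - q k)))"
  have X: "X (u + v) = X u + X v" "X (u - v) = X u - X v" "X (r *\<^sub>R u) = r * X u" "X (- u) = - X u"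
    for u v r by (simp_all add: X_def algebra_simps)
  have rest: "bodies - {k} = {i, j, l}" "bodies - {l} = {i, j, k}" using dist ijkl by auto
  have kl: "k \<in> bodies" "l \<in> bodies" using ijkl by auto
  have fk: "- lam *\<^sub>R (q k - center_of_mass m q) =
      (m i * R i k) *\<^sub>R (q i - q k) + (m j * R j k) *\<^sub>R (q j - q k) + (m l * R l k) *\<^sub>R (q l - q k)"
    using lam[OF kl(1)] dist unfolding rest by (simp add: R_def)
  have fl: "- lam *\<^sub>R (q l - center_of_mass m q) =
      (m i * R i l) *\<^sub>R (q i - q l) + (m j * R j l) *\<^sub>R (q j - q l) + (m k * R k l) *\<^sub>R (q k - q l)"
    using lam[OF kl(2)] dist unfolding rest by (simp add: R_def)
  have Xd: "X (q l - q k) = 0" by (simp add: X_def algebra_simps)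
  then have Xl: "X (q l) = X (q k)" by (simp add: X)
  \<comment> \<open>Both axis bodies have the same orthogonal component, so the multiplier and the
    center of mass drop out.\<close>
  have "X (- lam *\<^sub>R (q k - center_of_mass m q)) = X (- lam *\<^sub>R (q l - center_of_mass m q))"
    unfolding X by (simp add: Xl)
  then have eq: "m i * R i k * X (q i - q k) + m j * R j k * X (q j - q k) =
     m i * R i l * X (q i - q k) + m j * R j l * X (q j - q k)"
    unfolding fk fl by (simp add: X Xl)
  have Xcoord: "X (z - q k) = Im (axis_coord (q k) (q l) z) * (cmod (q l - q k))\<^sup>2" for z
    unfolding X_def by (rule Im_mult_cnj_axis[OF qkl])
  have "axis_coord (q k) (q l) (q j) = cnj (axis_coord (q k) (q l) (q i))"
    using qkl by (simp flip: refl)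
  then have Xj: "X (q j - q k) = - X (q i - q k)" unfolding Xcoord by simp
  have Rj: "R j k = R i k" "R j l = R i l"
    using cmod_reflect_diff[OF qkl] by (simp_all add: R_def refl [symmetric])
  \<comment> \<open>By symmetry the off-axis bodies have equal distances and opposite orthogonal
    components, so only the mass difference survives. The other two factors are nonzero.\<close>
  have "(m i - m j) * ((R i k - R i l) * X (q i - q k)) = 0"
    using eq unfolding Xj Rj by (simp add: algebra_simps)
  moreover have "X (q i - q k) \<noteq> 0"
    unfolding Xcoord using off qkl by simp
  moreover have "R i k \<noteq> R i l"
  proof -
    have "0 < cmod (q i - q k)" using off by auto
    then show ?thesis
      using apex_further_than_inner_point[OF qkl, of "q i"] hull refl
      by (auto simp: R_def power_eq_iff_eq_base)
  qed
  ultimately show ?thesis by simp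
qed

lemma concave_kiteE:
  assumes cc: "central_config m q" and kite: "is_kite q" and conc: "is_concave q"
  obtains i j k l where "{i, j, k, l} = bodies" "m i = m j"
    "reflect (q k) (q l) (q i) = q j" "q k \<in> interior (convex hull {q i, q j, q l})"
proof -
  from kite obtain s t where st: "s \<in> bodies" "t \<in> bodies" "q s \<noteq> q t"
    and img: "reflect (q s) (q t) ` (q ` bodies) = q ` bodies"
    and nc: "\<not> collinear (q ` bodies)"
    by (auto simp: is_kite_def)
  from conc obtain k where k: "k \<in> bodies" and
    int: "q k \<in> interior (convex hull (q ` (bodies - {k})))"
    by (auto simp: is_concave_def)
  have hull: "q k \<in> convex hull (q ` (bodies - {k}))"
    using int interior_subset by blast
  \<comment> \<open>Otherwise the fourth body \<open>j\<close> is the mirror image of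
    \<open>k\<close>, and \<open>k\<close> would lie in the hull of the axis points and its own
    image.\<close>
  have "k \<in> {s, t}"
  proof (rule ccontr)
    assume "k \<notin> {s, t}"
    then have "card (bodies - {s, t, k}) = 1"
      using st k by (cases "s = t") (auto simp: card_Diff_subset bodies_def)
    then obtain j where "bodies - {s, t, k} = {j}" by (rule card_1_singletonE)
    then have j: "bodies = {s, t, k, j}" "j \<notin> {s, t, k}" using st k by auto
    have "bodies - {k} = {s, t, j}" using j \<open>k \<notin> {s, t}\<close> by auto
    then have inh: "q k \<in> convex hull {q s, q t, q j}" using hull by simp
    have "q ` bodies = {q s, q t, q k, q j}" unfolding j(1) by simp
    then have "reflect (q s) (q t) (q k) = q j" "Im (axis_coord (q s) (q t) (q k)) \<noteq> 0"
      using reflection_swaps[OF st(3) _ nc img] by blast+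
    with off_axis_not_in_hull[OF st(3), of "q k"] inh show False by simp
  qed
  then obtain l where l: "l \<in> bodies" "q k \<noteq> q l" "reflect (q k) (q l) ` (q ` bodies) = q ` bodies"
  proof (elim insertE emptyE)
    assume "k = s"
    show ?thesis by (rule that[of t]) (use st img \<open>k = s\<close> in simp_all)
  next
    assume "k = t"
    have "reflect (q s) (q t) = reflect (q t) (q s)"
      using reflect_commute[OF st(3)] by blast
    then show ?thesis using st img \<open>k = t\<close> by (intro that[of s]) auto
  qed
  have "l \<noteq> k" using l by auto
  then have "card (bodies - {k, l}) = 2"
    using k l by (auto simp: card_Diff_subset bodies_def)
  then obtain i j where "bodies - {k, l} = {i, j}" "i \<noteq> j" by (auto simp: card_2_iff)
  then have ij: "bodies = {k, l, i, j}" "i \<notin> {k, l}" "j \<notin> {k, l, i}" using k l by auto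
  have "q ` bodies = {q k, q l, q i, q j}" unfolding ij(1) by simp
  then have refl: "reflect (q k) (q l) (q i) = q j" and off: "Im (axis_coord (q k) (q l) (q i)) \<noteq> 0"
    using reflection_swaps[OF l(2) _ nc l(3)] by blast+
  have eq: "{i, j, k, l} = bodies" using ij by auto
  have "bodies - {k} = {i, j, l}" using ij \<open>l \<noteq> k\<close> by auto
  then have int': "q k \<in> interior (convex hull {q i, q j, q l})" using int by simp
  then have "q k \<in> convex hull {q i, q j, q l}" using interior_subset by blast
  from off_axis_masses_equal[OF cc eq refl off this] have "m i = m j" .
  from that[OF eq this refl int'] show ?thesis .
qed

text \<open>Every body has a partner of equal mass. If \<open>k\<close> and \<open>l\<close> were
  not partners of each other, both would have the mass of \<open>i\<close> and so agree
  anyway.\<close>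

lemma two_pairs_equal_remaining:
  assumes "two_pairs_equal m" and ijkl: "{i, j, k, l} = bodies" and "m i = m j"
  shows "m k = m l"
proof -
  from assms(1) obtain a b c d where abcd: "{a, b, c, d} = bodies" "m a = m b" "m c = m d"
    by (auto simp: two_pairs_equal_def)
  have partner: "\<exists>t\<in>bodies. t \<noteq> s \<and> m t = m s" if "s \<in> bodies" for s
    using that abcd(2,3) distinct_if_eq_bodies[OF abcd(1)] unfolding abcd(1) [symmetric] by auto
  have k: "m k = m l \<or> m k = m i" and l: "m k = m l \<or> m l = m i"
    using partner[of k] partner[of l] \<open>m i = m j\<close> unfolding ijkl [symmetric] by auto
  then show ?thesis by auto
qed

section \<open>Scalar equations of the normalized kite\<close>

definition leg :: "real \<Rightarrow> real" where
  "leg y = sqrt (1 + y\<^sup>2)"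

text \<open>With legs \<open>a = leg x\<close> and \<open>b = leg y\<close> the inner and outer axis bodies sit at heights
  \<open>x < y\<close>; the base length is 2, whence the constant \<open>1 / 8 = 1 / 2 ^ 3\<close>.\<close>

definition base_pull :: "real \<Rightarrow> real" where
  "base_pull y = y * (1 / 8 - 1 / leg y ^ 3)"

definition kite_eqs :: "real \<Rightarrow> real \<Rightarrow> real \<Rightarrow> bool" where
  "kite_eqs x y mu \<longleftrightarrow>
     mu * (y - x) * (1 / (y - x) ^ 3 - 1 / leg y ^ 3) = - 2 * base_pull x \<and>
     mu * (y - x) * (1 / (y - x) ^ 3 - 1 / leg x ^ 3) = 2 * base_pull y"

text \<open>The quotient of the two left sides of \<open>kite_eqs\<close>, from which
  \<open>mu\<close> cancels.\<close>

definition pull_ratio :: "real \<Rightarrow> real \<Rightarrow> real" where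
  "pull_ratio x y = (1 / (y - x) ^ 3 - 1 / leg x ^ 3) / (1 / (y - x) ^ 3 - 1 / leg y ^ 3)"

lemma leg_pos [simp]: "0 < leg y"
  by (simp add: leg_def add_pos_nonneg)

lemma leg_nonneg [simp]: "0 \<le> leg y"
  by (simp add: leg_def)

lemma leg_power2: "(leg y)\<^sup>2 = 1 + y\<^sup>2"
  by (simp add: leg_def)

lemma continuous_on_leg: "continuous_on S leg"
  unfolding leg_def by (intro continuous_intros)

lemma leg_strict_mono: "0 \<le> x \<Longrightarrow> x < y \<Longrightarrow> leg x < leg y"
  by (simp add: leg_def power_strict_mono)

lemma less_leg: "y < leg y"
  unfolding leg_def by (rule real_less_rsqrt) simp

lemma leg_sqrt3: "leg (sqrt 3) = 2"
  by (simp add: leg_def)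

lemma cube_less_iff:
  fixes u v :: real
  assumes "0 < u" "0 < v"
  shows "u ^ 3 < v ^ 3 \<longleftrightarrow> u < v"
  using assms power_mono_iff[of v u 3] by (simp flip: not_le)

text \<open>By symmetry bodies 1 and 2 give the same two real equations, and bodies 3 and 4 give one
  vertical equation each. The definition of the center of mass makes one vertical equation
  redundant; the horizontal one supplies the multiplier.\<close>

lemma norm_central_config_iff:
  assumes x: "0 < x" and xy: "x < y" and mu: "0 < mu"
  shows "central_config (norm_mass mu) (norm_pos (leg x) (leg y)) \<longleftrightarrow> kite_eqs x y mu"
proof -
  define q where "q = norm_pos (leg x) (leg y)"
  define A B D where "A = 1 / leg x ^ 3" and "B = 1 / leg y ^ 3" and "D = 1 / (y - x) ^ 3"
  \<comment> \<open>The height of the center of mass.\<close>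
  define C where "C = mu * (x + y) / (2 + 2 * mu)"
  have q: "q 1 = -1" "q 2 = 1" "q 3 = Complex 0 x" "q 4 = Complex 0 y"
    using x xy by (simp_all add: q_def norm_pos_def leg_power2)
  have m: "norm_mass mu 1 = 1" "norm_mass mu 2 = 1" "norm_mass mu 3 = mu" "norm_mass mu 4 = mu"
    by (simp_all add: norm_mass_def)
  have rest: "bodies - {1} = {2, 3, 4}" "bodies - {2} = {1, 3, 4}"
    "bodies - {3} = {1, 2, 4}" "bodies - {4} = {1, 2, 3}"
    by (auto simp: bodies_eq)
  have com: "center_of_mass (norm_mass mu) q = Complex 0 C"
  proof -
    have "(\<Sum>i\<in>bodies. norm_mass mu i) = 2 + 2 * mu"
      unfolding bodies_eq using m by simp
    moreover have "(\<Sum>i\<in>bodies. norm_mass mu i *\<^sub>R q i) = Complex 0 (mu * (x + y))"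
      unfolding bodies_eq using m q by (simp add: complex_eq_iff algebra_simps)
    ultimately show ?thesis by (simp add: center_of_mass_def C_def complex_eq_iff)
  qed
  have inj: "inj_on q bodies"
    using x xy unfolding bodies_eq by (auto simp: q [simplified] complex_eq_iff)
  have d: "cmod (q 2 - q 1) = 2" "cmod (q 1 - q 2) = 2"
    "cmod (q 3 - q 1) = leg x" "cmod (q 1 - q 3) = leg x"
    "cmod (q 3 - q 2) = leg x" "cmod (q 2 - q 3) = leg x"
    "cmod (q 4 - q 1) = leg y" "cmod (q 1 - q 4) = leg y"
    "cmod (q 4 - q 2) = leg y" "cmod (q 2 - q 4) = leg y"
    "cmod (q 3 - q 4) = y - x" "cmod (q 4 - q 3) = y - x"
    using xy unfolding q by (simp_all add: cmod_def leg_def)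
  have mpos: "\<forall>i\<in>bodies. 0 < norm_mass mu i"
    using mu by (simp add: norm_mass_def)
  have "central_config (norm_mass mu) q \<longleftrightarrow>
     (\<exists>lam. lam = 1 / 4 + mu * A + mu * B \<and> lam * C = mu * (x * A + y * B)
        \<and> lam * (x - C) = 2 * x * A - mu * (y - x) * D
        \<and> lam * (y - C) = 2 * y * B + mu * (y - x) * D)" (is "_ \<longleftrightarrow> (\<exists>lam. ?P lam)")
  proof -
    have "(\<forall>j\<in>bodies. - (lam * norm_mass mu j) *\<^sub>R (q j - center_of_mass (norm_mass mu) q)
          = (\<Sum>i\<in>bodies - {j}. (norm_mass mu i * norm_mass mu j / (cmod (q i - q j)) ^ 3) *\<^sub>R (q i - q j)))
       \<longleftrightarrow> ?P lam" for lam
    proof -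
      \<comment> \<open>The real part gives the value of \<open>lam\<close>, the imaginary part the
        equation for \<open>C\<close>.\<close>
      have P1: "- (lam * 1) *\<^sub>R (q 1 - Complex 0 C) =
          (1 * 1 / 2 ^ 3) *\<^sub>R (q 2 - q 1) + ((mu * 1 / leg x ^ 3) *\<^sub>R (q 3 - q 1)
          + (mu * 1 / leg y ^ 3) *\<^sub>R (q 4 - q 1))
        \<longleftrightarrow> lam = 1 / 4 + mu * A + mu * B \<and> lam * C = mu * (x * A + y * B)"
        unfolding q A_def B_def by (auto simp: complex_eq_iff algebra_simps)
      have P2: "- (lam * 1) *\<^sub>R (q 2 - Complex 0 C) =
          (1 * 1 / 2 ^ 3) *\<^sub>R (q 1 - q 2) + ((mu * 1 / leg x ^ 3) *\<^sub>R (q 3 - q 2)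
          + (mu * 1 / leg y ^ 3) *\<^sub>R (q 4 - q 2))
        \<longleftrightarrow> lam = 1 / 4 + mu * A + mu * B \<and> lam * C = mu * (x * A + y * B)"
        unfolding q A_def B_def by (auto simp: complex_eq_iff algebra_simps)
      \<comment> \<open>The pulls of the base bodies cancel horizontally. The common factor
        \<open>mu\<close> is kept here and cancelled when the four equivalences are
        combined.\<close>
      have P3: "- (lam * mu) *\<^sub>R (q 3 - Complex 0 C) =
          (1 * mu / leg x ^ 3) *\<^sub>R (q 1 - q 3) + ((1 * mu / leg x ^ 3) *\<^sub>R (q 2 - q 3)
          + (mu * mu / (y - x) ^ 3) *\<^sub>R (q 4 - q 3))
        \<longleftrightarrow> mu * (lam * (x - C)) = mu * (2 * x * A - mu * (y - x) * D)"
        unfolding q A_def D_def by (auto simp: complex_eq_iff algebra_simps add_divide_distrib diff_divide_distrib)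
      have P4: "- (lam * mu) *\<^sub>R (q 4 - Complex 0 C) =
          (1 * mu / leg y ^ 3) *\<^sub>R (q 1 - q 4) + ((1 * mu / leg y ^ 3) *\<^sub>R (q 2 - q 4)
          + (mu * mu / (y - x) ^ 3) *\<^sub>R (q 3 - q 4))
        \<longleftrightarrow> mu * (lam * (y - C)) = mu * (2 * y * B + mu * (y - x) * D)"
        unfolding q B_def D_def by (auto simp: complex_eq_iff algebra_simps add_divide_distrib diff_divide_distrib)
      have split: "(\<forall>j\<in>bodies. Q j) \<longleftrightarrow> Q 1 \<and> Q 2 \<and> Q 3 \<and> Q 4" for Q
        by (auto simp: bodies_eq)
      have s: "sum f {2, 3, 4} = f 2 + (f 3 + f 4)" "sum f {1, 3, 4} = f 1 + (f 3 + f 4)"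
        "sum f {1, 2, 4} = f 1 + (f 2 + f 4)" "sum f {1, 2, 3} = f 1 + (f 2 + f 3)"
        for f :: "nat \<Rightarrow> complex"
        by simp_all
      show ?thesis
        unfolding com split rest s m d P1 P2 P3 P4 using mu by auto
    qed
    then show ?thesis using mpos inj by (simp add: central_config_def)
  qed
  also have "\<dots> \<longleftrightarrow> mu * (y - x) * (D - B) = 2 * (x * (A - 1 / 8)) \<and>
      mu * (y - x) * (D - A) = 2 * (y * (1 / 8 - B))" (is "?L \<longleftrightarrow> ?R")
  proof -
    have C: "(2 + 2 * mu) * C = mu * (x + y)" using mu by (simp add: C_def)
    show ?thesis
    proof
      assume ?L
      then obtain lam where l: "lam = 1 / 4 + mu * A + mu * B"
        and e2: "lam * C = mu * (x * A + y * B)"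
        and e3: "lam * (x - C) = 2 * x * A - mu * (y - x) * D"
        and e4: "lam * (y - C) = 2 * y * B + mu * (y - x) * D" by blast
      \<comment> \<open>\<open>C\<close> is eliminated through
        \<open>mu * (x + y) = (2 + 2 * mu) * C\<close>. The sum and difference of \<open>E1\<close>
        and \<open>E2\<close> are then the two target equations.\<close>
      have "mu * (lam * (x + y)) = mu * ((2 + 2 * mu) * (x * A + y * B))"
      proof -
        have "mu * (lam * (x + y)) = (2 + 2 * mu) * (lam * C)" using C by algebra
        then show ?thesis unfolding e2 by algebra
      qed
      then have E2: "lam * (x + y) = (2 + 2 * mu) * (x * A + y * B)" using mu by simp
      have E1: "lam * (y - x) = 2 * y * B - 2 * x * A + 2 * mu * (y - x) * D"
        using e3 e4 by (simp add: algebra_simps)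
      show ?R using E1 E2 unfolding l
        by (intro conjI; simp add: algebra_simps add_divide_distrib diff_divide_distrib)
    next
      assume R: ?R
      define lam where "lam = 1 / 4 + mu * A + mu * B"
      have E2: "lam * (x + y) = (2 + 2 * mu) * (x * A + y * B)"
        and E1: "lam * (y - x) = 2 * y * B - 2 * x * A + 2 * mu * (y - x) * D"
        using R unfolding lam_def by (simp_all add: algebra_simps add_divide_distrib diff_divide_distrib)
      have "(2 + 2 * mu) * (lam * C) = (2 + 2 * mu) * (mu * (x * A + y * B))"
        using C E2 by algebra
      then have e2: "lam * C = mu * (x * A + y * B)" using mu by simp
      have "lam * (x - C) = 2 * x * A - mu * (y - x) * D"
        "lam * (y - C) = 2 * y * B + mu * (y - x) * D"
        using E1 E2 e2 by (simp_all add: algebra_simps)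
      with e2 lam_def show ?L by blast
    qed
  qed
  also have "\<dots> \<longleftrightarrow> kite_eqs x y mu"
    by (simp add: kite_eqs_def base_pull_def A_def B_def D_def algebra_simps)
  finally show ?thesis unfolding q_def .
qed

section \<open>Monotonicity and sign of the two sides\<close>

text \<open>The subtracted term \<open>y / leg y ^ 3\<close> does not increase for
  \<open>y \<ge> 1\<close>. Squaring turns this into a polynomial inequality in \<open>s\<close> and
  \<open>t\<close>.\<close>

lemma base_pull_strict_mono:
  assumes "1 \<le> y" "y < z"
  shows "base_pull y < base_pull z"
proof -
  define s t where "s = y\<^sup>2" and "t = z\<^sup>2"
  have s: "1 \<le> s" using assms by (simp add: s_def one_le_power)
  have st: "s < t" using assms by (simp add: s_def t_def power_strict_mono)
  have "1 \<le> s * t" using s st mult_mono[of 1 s 1 t] by simp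
  moreover have "0 \<le> s * t * (s + t)" using s st by simp
  \<comment> \<open>This product is the factorization of
    \<open>s * (1 + t) ^ 3 - t * (1 + s) ^ 3\<close>.\<close>
  ultimately have "0 \<le> (t - s) * (3 * (s * t) + s * t * (s + t) - 1)"
    using st by (intro mult_nonneg_nonneg) auto
  then have "t * (1 + s) ^ 3 \<le> s * (1 + t) ^ 3"
    by (simp add: power3_eq_cube algebra_simps)
  moreover have "(u * v ^ 3)\<^sup>2 = u\<^sup>2 * (v\<^sup>2) ^ 3" for u v :: real
    by (simp add: power_mult_distrib)
  ultimately have "(z * leg y ^ 3)\<^sup>2 \<le> (y * leg z ^ 3)\<^sup>2"
    by (simp only: leg_power2 s_def t_def)
  then have "z * leg y ^ 3 \<le> y * leg z ^ 3"
    by (rule power2_le_imp_le) (use assms in simp)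
  then have "z / leg z ^ 3 \<le> y / leg y ^ 3"
    by (simp add: pos_divide_le_eq pos_le_divide_eq mult.commute)
  moreover have "base_pull u = u / 8 - u / leg u ^ 3" for u
    by (simp add: base_pull_def algebra_simps)
  ultimately show ?thesis using assms by simp
qed

text \<open>At height \<open>sqrt 3\<close> the legs equal the base length 2, so the triangle is
  equilateral.\<close>

lemma base_pull_sign:
  assumes "0 < y"
  shows "base_pull y < 0 \<longleftrightarrow> y < sqrt 3" "0 \<le> base_pull y \<longleftrightarrow> sqrt 3 \<le> y"
proof -
  have *: "base_pull y < 0 \<longleftrightarrow> y < sqrt 3"
  proof -
    have "base_pull y < 0 \<longleftrightarrow> 1 / 8 < 1 / leg y ^ 3"
      using assms by (simp add: base_pull_def mult_less_0_iff)
    also have "\<dots> \<longleftrightarrow> leg y ^ 3 < 2 ^ 3" by (simp add: field_simps)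
    also have "\<dots> \<longleftrightarrow> leg y < 2" by (simp only: cube_less_iff leg_pos zero_less_numeral)
    also have "\<dots> \<longleftrightarrow> leg y < leg (sqrt 3)" by (simp add: leg_sqrt3)
    also have "\<dots> \<longleftrightarrow> y < sqrt 3"
      using leg_strict_mono[of y "sqrt 3"] leg_strict_mono[of "sqrt 3" y] assms
      by (cases y "sqrt 3" rule: linorder_cases) auto
    finally show ?thesis .
  qed
  show "base_pull y < 0 \<longleftrightarrow> y < sqrt 3" by (rule *)
  show "0 \<le> base_pull y \<longleftrightarrow> sqrt 3 \<le> y" using * by linarith
qed

lemma inverse_cube_less_iff:
  fixes u v :: real
  assumes "0 < u" "0 < v"
  shows "1 / u ^ 3 < 1 / v ^ 3 \<longleftrightarrow> v < u"
  using assms cube_less_iff[of v u] by (simp add: field_simps)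

text \<open>Because \<open>y - x < y < leg y\<close>. This makes the denominator of
  \<open>pull_ratio\<close> positive.\<close>

lemma leg_cube_dominated:
  assumes "0 < x" "x < y"
  shows "1 / leg y ^ 3 < 1 / (y - x) ^ 3"
  using assms less_leg[of y] by (subst inverse_cube_less_iff) auto

text \<open>With \<open>A\<close>, \<open>B\<close>, \<open>D\<close> for the inverse cubes, the
  ratio is \<open>1 - (A - B) / (D - B)\<close>. Expanding the fraction by
  \<open>(y - x) ^ 3\<close> gives \<open>h\<close>, with increasing numerator and decreasing
  positive denominator.\<close>

lemma pull_ratio_strict_antimono:
  assumes x: "0 < x" and xy: "x < y" and yz: "y < z"
  shows "pull_ratio x z < pull_ratio x y"
proof -
  define h where "h = (\<lambda>y. (1 / leg x ^ 3 - 1 / leg y ^ 3) * (y - x) ^ 3 / (1 - ((y - x) / leg y) ^ 3))"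
  have r: "pull_ratio x y = 1 - h y" if "x < y" for y
  proof -
    define A B D where "A = 1 / leg x ^ 3" and "B = 1 / leg y ^ 3" and "D = 1 / (y - x) ^ 3"
    have D: "B < D" using leg_cube_dominated x that unfolding B_def D_def by blast
    have "pull_ratio x y = (D - A) / (D - B)" by (simp add: pull_ratio_def A_def B_def D_def)
    also have "\<dots> = 1 - (A - B) / (D - B)" using D by (simp add: field_simps)
    also have "D - B = (1 - ((y - x) / leg y) ^ 3) / (y - x) ^ 3"
    proof -
      have "1 / c ^ 3 - 1 / l ^ 3 = (1 - (c / l) ^ 3) / c ^ 3" if "c \<noteq> 0" for c l :: real
        using that by (simp add: power_divide diff_divide_distrib)
      from this[of "y - x" "leg y"] show ?thesis using that by (simp add: B_def D_def)
    qed
    finally show ?thesis by (simp add: h_def A_def B_def)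
  qed
  \<comment> \<open>\<open>h\<close> increases because \<open>(y - x) / leg y\<close> does.\<close>
  have "((y - x) * leg z)\<^sup>2 < ((z - x) * leg y)\<^sup>2"
  proof -
    \<comment> \<open>The difference of the two squares below: expanding
      \<open>1 + y\<^sup>2\<close> and \<open>1 + z\<^sup>2\<close> leaves two differences of
      squares, both divisible by \<open>z - y\<close>.\<close>
    have "0 < (z - y) * ((z - x) + (y - x) + x * ((z - x) * y + (y - x) * z))"
      using x xy yz by (intro mult_pos_pos add_pos_pos) auto
    then show ?thesis
      unfolding power_mult_distrib leg_power2 by (simp add: power2_eq_square algebra_simps)
  qed
  then have "(y - x) * leg z < (z - x) * leg y"
    by (rule power2_less_imp_less) (use xy yz in simp)
  then have "(y - x) / leg y < (z - x) / leg z"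
    by (simp add: pos_divide_less_eq pos_less_divide_eq mult.commute)
  then have r_less: "((y - x) / leg y) ^ 3 < ((z - x) / leg z) ^ 3"
    by (rule power_strict_mono) (use xy in simp_all)
  have "(z - x) / leg z < 1" using x less_leg[of z] by (simp add: pos_divide_less_eq)
  then have "((z - x) / leg z) ^ 3 < 1 ^ 3"
    by (rule power_strict_mono) (use xy yz in simp_all)
  then have den: "0 < 1 - ((z - x) / leg z) ^ 3" by simp
  have c: "(y - x) ^ 3 < (z - x) ^ 3"
    by (rule power_strict_mono) (use xy yz in simp_all)
  have A: "0 < 1 / leg x ^ 3 - 1 / leg y ^ 3"
    using x xy inverse_cube_less_iff[of "leg y" "leg x"] leg_strict_mono[of x y] by simp
  have B: "1 / leg x ^ 3 - 1 / leg y ^ 3 < 1 / leg x ^ 3 - 1 / leg z ^ 3"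
    using x xy yz inverse_cube_less_iff[of "leg z" "leg y"] leg_strict_mono[of y z] by simp
  have "(1 / leg x ^ 3 - 1 / leg y ^ 3) * (y - x) ^ 3 < (1 / leg x ^ 3 - 1 / leg z ^ 3) * (z - x) ^ 3"
    by (rule mult_strict_mono[OF B c]) (use A B xy in simp_all)
  moreover have "0 \<le> (1 / leg x ^ 3 - 1 / leg y ^ 3) * (y - x) ^ 3"
    by (rule mult_nonneg_nonneg) (use A xy in simp_all)
  ultimately have "h y < h z"
    unfolding h_def using den r_less by (intro frac_less) simp_all
  then show ?thesis using r[OF xy] r[of z] xy yz by simp
qed

text \<open>The first equation can be solved for \<open>mu\<close>; inserting it into the second
  leaves a condition on \<open>x\<close> and \<open>y\<close> alone.\<close>

lemma kite_eqs_iff: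
  assumes "0 < x" "x < y"
  shows "kite_eqs x y mu \<longleftrightarrow>
    base_pull y = - base_pull x * pull_ratio x y \<and>
    mu = - 2 * base_pull x / ((y - x) * (1 / (y - x) ^ 3 - 1 / leg y ^ 3))"
proof -
  define E where "E = 1 / (y - x) ^ 3 - 1 / leg y ^ 3"
  define E' where "E' = 1 / (y - x) ^ 3 - 1 / leg x ^ 3"
  have E: "0 < E" using leg_cube_dominated[OF assms] by (simp add: E_def)
  have c: "0 < y - x" using assms by simp
  have eqs: "kite_eqs x y mu \<longleftrightarrow>
      mu * (y - x) * E = - 2 * base_pull x \<and> mu * (y - x) * E' = 2 * base_pull y"
    by (simp add: kite_eqs_def E_def E'_def)
  have ratio: "pull_ratio x y = E' / E" by (simp add: pull_ratio_def E_def E'_def)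
  have mu: "mu * (y - x) * E = - 2 * base_pull x \<longleftrightarrow> mu = - 2 * base_pull x / ((y - x) * E)"
  proof -
    have "(y - x) * E \<noteq> 0" using E c by simp
    from nonzero_eq_divide_eq[OF this] show ?thesis by (simp only: mult.assoc)
  qed
  have "mu * (y - x) * E' = 2 * base_pull y \<longleftrightarrow> base_pull y = - base_pull x * (E' / E)"
    if "mu * (y - x) * E = - 2 * base_pull x"
  proof -
    have "mu * (y - x) * E' = - 2 * base_pull x * (E' / E)"
      using E unfolding that [symmetric] by simp
    then show ?thesis by auto
  qed
  then show ?thesis unfolding eqs ratio mu E_def [symmetric] using mu by blast
qed

section \<open>Solving the scalar equations\<close>

lemma kite_eqs_inner_less:
  assumes "0 < x" "x < y" "0 < mu" "kite_eqs x y mu"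
  shows "x < sqrt 3"
proof -
  have "0 < mu * (y - x) * (1 / (y - x) ^ 3 - 1 / leg y ^ 3)"
    using assms leg_cube_dominated[of x y] by simp
  then have "base_pull x < 0" using assms(4) by (simp add: kite_eqs_def)
  then show ?thesis using base_pull_sign assms(1) by blast
qed

text \<open>Places every solution in the range where \<open>base_pull_strict_mono\<close>
  applies.\<close>

lemma kite_eqs_outer_gt_1:
  assumes "0 < x" "x < y" "0 < mu" "kite_eqs x y mu"
  shows "1 < y"
proof (cases "y < sqrt 3")
  case True
  then have "base_pull y < 0" using base_pull_sign assms by simp
  then have "mu * (y - x) * (1 / (y - x) ^ 3 - 1 / leg x ^ 3) < 0"
    using assms(4) by (simp add: kite_eqs_def)
  moreover have "0 < mu * (y - x)" using assms by simp
  ultimately have "1 / (y - x) ^ 3 < 1 / leg x ^ 3"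
    using mult_less_cancel_left_pos[of "mu * (y - x)" _ 0] by auto
  then have "leg x < y - x" using assms by (simp only: inverse_cube_less_iff leg_pos)
  moreover have "leg 0 < leg x" using assms by (intro leg_strict_mono) auto
  then have "1 < leg x" by (simp add: leg_def)
  ultimately show ?thesis using assms by simp
next
  case False
  moreover have "1 < sqrt 3" by simp
  ultimately show ?thesis by linarith
qed

lemma kite_eqs_unique:
  assumes x: "0 < x" and y: "x < y" "0 < mu" "kite_eqs x y mu" and z: "x < z" "0 < nu" "kite_eqs x z nu"
  shows "y = z \<and> mu = nu"
proof -
  have neg: "base_pull x < 0"
    using kite_eqs_inner_less[OF x y] base_pull_sign x by blast
  \<comment> \<open>Between two solutions \<open>u < v\<close> the left side would rise strictly
    while the right side falls strictly.\<close>
  have no: False if "x < u" "u < v" "1 < u" "base_pull u = - base_pull x * pull_ratio x u"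
    "base_pull v = - base_pull x * pull_ratio x v" for u v
  proof -
    have "base_pull x * pull_ratio x u < base_pull x * pull_ratio x v"
      by (rule mult_strict_left_mono_neg[OF pull_ratio_strict_antimono[OF x that(1,2)] neg])
    moreover have "base_pull u < base_pull v" using base_pull_strict_mono[of u v] that(2,3) by simp
    moreover have "base_pull u + base_pull x * pull_ratio x u = 0"
      "base_pull v + base_pull x * pull_ratio x v = 0" using that(4,5) by simp_all
    ultimately show False by linarith
  qed
  have gt: "1 < y" "1 < z" using kite_eqs_outer_gt_1 x y z by blast+
  have eqs: "base_pull y = - base_pull x * pull_ratio x y" "base_pull z = - base_pull x * pull_ratio x z"
    using kite_eqs_iff x y z by blast+
  have "y = z"
    using no[of y z] no[of z y] gt eqs y(1) z(1) by (cases y z rule: linorder_cases) auto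
  then show ?thesis using kite_eqs_iff x y z by metis
qed

lemma kite_eqs_exists:
  assumes x: "0 < x" "x < sqrt 3"
  shows "\<exists>y mu. x < y \<and> 0 < mu \<and> kite_eqs x y mu"
proof -
  \<comment> \<open>The difference of the two sides of the \<open>mu\<close>-free equation; a zero
    is sought by the intermediate value theorem.\<close>
  define H where "H = (\<lambda>y. base_pull y + base_pull x * pull_ratio x y)"
  have neg: "base_pull x < 0" using base_pull_sign x by simp
  have pull: "0 \<le> pull_ratio x y \<longleftrightarrow> y \<le> x + leg x" "pull_ratio x y \<le> 0 \<longleftrightarrow> x + leg x \<le> y"
    if "x < y" for y
  proof -
    have E: "0 < 1 / (y - x) ^ 3 - 1 / leg y ^ 3" using leg_cube_dominated x that by simp
    have "0 \<le> pull_ratio x y \<longleftrightarrow> \<not> 1 / (y - x) ^ 3 < 1 / leg x ^ 3"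
      using E by (simp add: pull_ratio_def pos_le_divide_eq not_less)
    also have "\<dots> \<longleftrightarrow> y \<le> x + leg x"
      by (subst inverse_cube_less_iff) (use that in auto)
    finally show "0 \<le> pull_ratio x y \<longleftrightarrow> y \<le> x + leg x" .
    have "pull_ratio x y \<le> 0 \<longleftrightarrow> \<not> 1 / leg x ^ 3 < 1 / (y - x) ^ 3"
      using E by (simp add: pull_ratio_def pos_divide_le_eq not_less)
    also have "\<dots> \<longleftrightarrow> x + leg x \<le> y"
      by (subst inverse_cube_less_iff) (use that in auto)
    finally show "pull_ratio x y \<le> 0 \<longleftrightarrow> x + leg x \<le> y" .
  qed
  have cont: "continuous_on {u..v} H" if "x < u" for u v
  proof -
    have "1 / (y - x) ^ 3 - 1 / leg y ^ 3 \<noteq> 0" if "y \<in> {u..v}" for y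
      using leg_cube_dominated[of x y] x \<open>x < u\<close> that by fastforce
    moreover have "(y - x) ^ 3 \<noteq> 0" if "y \<in> {u..v}" for y using \<open>x < u\<close> that by simp
    moreover have "leg y ^ 3 \<noteq> 0" for y using zero_less_power[OF leg_pos, of y 3] by linarith
    ultimately show ?thesis
      unfolding H_def base_pull_def pull_ratio_def
      by (intro continuous_intros continuous_on_leg ballI)
  qed
  have ratio0: "pull_ratio x (x + leg x) = 0" by (simp add: pull_ratio_def)
  have pull0: "base_pull (sqrt 3) = 0" by (simp add: base_pull_def leg_sqrt3)
  have xl: "x < x + leg x" by simp
  have "\<exists>y>x. H y = 0"
  \<comment> \<open>\<open>base_pull\<close> vanishes at \<open>sqrt 3\<close> and
    \<open>pull_ratio x\<close> at \<open>x + leg x\<close>. Either height can be the larger, but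
    \<open>H\<close> is nonpositive at the smaller and nonnegative at the larger.\<close>
  proof (cases "sqrt 3 \<le> x + leg x")
    case True
    then have "H (sqrt 3) \<le> 0"
      using pull[OF x(2)] neg by (simp add: H_def pull0 mult_le_0_iff)
    moreover have "0 \<le> H (x + leg x)"
      using True base_pull_sign[of "x + leg x"] x by (simp add: H_def ratio0 add_pos_pos)
    ultimately obtain y where "sqrt 3 \<le> y" "H y = 0"
      using IVT'[of H "sqrt 3" 0 "x + leg x"] True cont[OF x(2)] by blast
    then show ?thesis using x by (intro exI[of _ y]) auto
  next
    case False
    then have "H (x + leg x) \<le> 0"
      using base_pull_sign[of "x + leg x"] x by (simp add: H_def ratio0 add_pos_pos)
    moreover have "0 \<le> H (sqrt 3)"
      using False pull[OF x(2)] neg by (simp add: H_def pull0 zero_le_mult_iff)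
    ultimately obtain y where "x + leg x \<le> y" "H y = 0"
      using IVT'[of H "x + leg x" 0 "sqrt 3"] False cont[OF xl] by auto
    then show ?thesis using less_le_trans[OF xl] by blast
  qed
  then obtain y where y: "x < y" "H y = 0" by blast
  define mu where "mu = - 2 * base_pull x / ((y - x) * (1 / (y - x) ^ 3 - 1 / leg y ^ 3))"
  have "0 < (y - x) * (1 / (y - x) ^ 3 - 1 / leg y ^ 3)"
    using leg_cube_dominated x y(1) by simp
  then have "0 < mu" using neg unfolding mu_def by (intro divide_pos_pos) auto
  moreover have "kite_eqs x y mu"
    using kite_eqs_iff[OF x(1) y(1)] y(2) by (simp add: H_def mu_def)
  ultimately show ?thesis using y(1) by blast
qed

section \<open>Back from heights to the leg lengths \<open>a\<close> and \<open>b\<close>\<close>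

lemma leg_surj:
  assumes "1 < a"
  shows "0 < sqrt (a\<^sup>2 - 1)" and "leg (sqrt (a\<^sup>2 - 1)) = a"
proof -
  have "1 < a\<^sup>2" using assms by (simp add: one_less_power)
  then show "0 < sqrt (a\<^sup>2 - 1)" "leg (sqrt (a\<^sup>2 - 1)) = a"
    using assms by (simp_all add: leg_def)
qed

lemma normalized_family_exists_unique:
  assumes a: "1 < a" "a < 2"
  shows "\<exists>!bm. a < fst bm \<and> 0 < snd bm \<and>
    central_config (norm_mass (snd bm)) (norm_pos a (fst bm))"
proof -
  define x where "x = sqrt (a\<^sup>2 - 1)"
  have x: "0 < x" "leg x = a" using leg_surj[OF a(1)] by (simp_all add: x_def)
  have "x < sqrt 3"
  proof -
    have "a\<^sup>2 < 2\<^sup>2" using a by (intro power_strict_mono) auto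
    then show ?thesis by (simp add: x_def)
  qed
  then obtain y mu where y: "x < y" "0 < mu" "kite_eqs x y mu" using kite_eqs_exists x by blast
  show ?thesis
  proof (rule ex1I[of _ "(leg y, mu)"])
    show "a < fst (leg y, mu) \<and> 0 < snd (leg y, mu) \<and>
      central_config (norm_mass (snd (leg y, mu))) (norm_pos a (fst (leg y, mu)))"
      using norm_central_config_iff[OF x(1) y(1,2)] y leg_strict_mono[of x y] x by simp
  next
    fix bm assume bm: "a < fst bm \<and> 0 < snd bm \<and>
      central_config (norm_mass (snd bm)) (norm_pos a (fst bm))"
    \<comment> \<open>The height that belongs to the competing leg length, so that uniqueness of
      heights applies.\<close>
    define z where "z = sqrt ((fst bm)\<^sup>2 - 1)"
    have z: "leg z = fst bm" using leg_surj[of "fst bm"] a bm by (simp add: z_def)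
    have "a\<^sup>2 < (fst bm)\<^sup>2" using a bm by (intro power_strict_mono) auto
    then have "x < z" by (simp add: x_def z_def)
    moreover from this have "kite_eqs x z (snd bm)"
      using norm_central_config_iff[OF x(1), of z "snd bm"] bm z x by simp
    ultimately have "y = z \<and> mu = snd bm" using kite_eqs_unique[OF x(1) y] bm by blast
    then show "bm = (leg y, mu)" using z by (simp add: prod_eq_iff)
  qed
qed

lemma normalized_family_bound:
  assumes "1 < a" "a < b" "0 < mu" and cc: "central_config (norm_mass mu) (norm_pos a b)"
  shows "a < 2"
proof -
  define x y where "x = sqrt (a\<^sup>2 - 1)" and "y = sqrt (b\<^sup>2 - 1)"
  have x: "0 < x" "leg x = a" and y: "leg y = b"
    using leg_surj[of a] leg_surj[of b] assms by (simp_all add: x_def y_def)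
  have "a\<^sup>2 < b\<^sup>2" using assms by (intro power_strict_mono) auto
  then have xy: "x < y" by (simp add: x_def y_def)
  have "kite_eqs x y mu" using norm_central_config_iff[OF x(1) xy assms(3)] cc x y by simp
  then have "x < sqrt 3" using kite_eqs_inner_less x xy assms(3) by blast
  then have "leg x < leg (sqrt 3)" using x by (intro leg_strict_mono) auto
  then show ?thesis using x by (simp add: leg_sqrt3)
qed

theorem theorem1:
  fixes m :: "nat \<Rightarrow> real" and q :: "nat \<Rightarrow> complex"
  assumes "central_config m q"
    and "is_kite q"
    and "is_concave q"
    and "two_pairs_equal m"
  shows "(\<exists>i j k l. {i, j, k, l} = bodies \<and> m i = m j \<and> m k = m l \<and>
             reflect (q k) (q l) (q i) = q j \<and>
             q k \<in> interior (convex hull {q i, q j, q l}))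
       \<and> (\<forall>a::real. 1 < a \<and> a < 2 \<longrightarrow>
             (\<exists>!bm::real \<times> real. a < fst bm \<and> 0 < snd bm \<and>
                 central_config (norm_mass (snd bm)) (norm_pos a (fst bm))))
       \<and> (\<forall>a b mu::real. 1 < a \<and> a < b \<and> 0 < mu \<and>
             central_config (norm_mass mu) (norm_pos a b) \<longrightarrow> a < 2)"
proof (intro conjI allI impI)
  obtain i j k l where kite: "{i, j, k, l} = bodies" "m i = m j"
    "reflect (q k) (q l) (q i) = q j" "q k \<in> interior (convex hull {q i, q j, q l})"
    using concave_kiteE[OF assms(1-3)] by metis
  moreover have "m k = m l" using two_pairs_equal_remaining[OF assms(4) kite(1,2)] .
  ultimately show "\<exists>i j k l. {i, j, k, l} = bodies \<and> m i = m j \<and> m k = m l \<and>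
      reflect (q k) (q l) (q i) = q j \<and> q k \<in> interior (convex hull {q i, q j, q l})"
    by blast
next
  fix a :: real
  assume "1 < a \<and> a < 2"
  then show "\<exists>!bm::real \<times> real. a < fst bm \<and> 0 < snd bm \<and>
      central_config (norm_mass (snd bm)) (norm_pos a (fst bm))"
    using normalized_family_exists_unique by blast
next
  fix a b mu :: real
  assume "1 < a \<and> a < b \<and> 0 < mu \<and> central_config (norm_mass mu) (norm_pos a b)"
  then show "a < 2" using normalized_family_bound by blast
qed

end
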